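(* Suppose that for some fixed nonnegative integer $L$ there are pairs $(k,s)$, with $k\ge2$ arbitrarily large and $s\ge0$, such that $|W_{k,s}|\le L$. Then $\Gamma$ has at most $L$ connected components. In particular, if $$\liminf_{k\to\infty}|\mathcal A_k(E_k)|=1,$$ then $\Gamma$ is connected, while if $\liminf_{k\to\infty}|\mathcal A_k(E_k)|\le2$, then $\Gamma$ has at most two connected components.
   Context: $\mathbb N=\{1,2,3,\dots\}$; $\tau(n)$ is the number of positive divisors of $n$; $T(n)=n+\tau(n)$, with iterates $T^s$. $\Gamma$ is the undirected graph with vertex set $\mathbb N$ and edge set $\{\{n,T(n)\}:n\in\mathbb N\}$. For $k\ge1$ the annular transfer map $\mathcal A_k:\{0,1,\dots,2k\}\to\{0,1,\dots,2k+2\}$ is defined as follows: for $0\le r\le 2k$, let $s\ge1$ be minimal with $T^s(k^2+r)\ge (k+1)^2$; then $\mathcal A_k(r)=T^s(k^2+r)-(k+1)^2$. For a set $A$ of offsets, $\mathcal A_k(A)=\{\mathcal A_k(r):r\in A\}$. For $k\ge2$ the exit set is $$E_k=\{\tau(k^2-j)-j:\ 1\le j\le 2k-2,\ \tau(k^2-j)\ge j\}\subseteq\{0,\dots,2k\}.$$ For $k\ge2$, $$W_{k,0}=E_k,\qquad W_{k,s}=\mathcal A_{k+s-1}(W_{k,s-1})\quad(s\ge1);$$ one has $W_{k,s}\subseteq E_{k+s}$, so the recursion is well defined. *)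

theory Defs
  imports Complex_Main "HOL-Library.Extended_Nat" "HOL-Library.Liminf_Limsup"
begin

definition tau :: "nat \<Rightarrow> nat" where
  "tau n = card {d. d dvd n}"

definition T :: "nat \<Rightarrow> nat" where
  "T n = n + tau n"

(* An undirected graph is a vertex set V together with a set E of two-element vertex sets.
   Its connected components are the classes of the relation "joined by a finite path". *)

definition adjacency :: "'a set set \<Rightarrow> 'a rel" where
  "adjacency E = {(u, v). {u, v} \<in> E}"

definition joined :: "'a set \<Rightarrow> 'a set set \<Rightarrow> 'a rel" where
  "joined V E = {(u, v). u \<in> V \<and> v \<in> V \<and> (u, v) \<in> (adjacency E)\<^sup>*}"

definition components :: "'a set \<Rightarrow> 'a set set \<Rightarrow> 'a set set" where
  "components V E = V // joined V E"

definition connected_graph :: "'a set \<Rightarrow> 'a set set \<Rightarrow> bool" where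
  "connected_graph V E \<longleftrightarrow> V \<noteq> {} \<and> (\<forall>u\<in>V. \<forall>v\<in>V. (u, v) \<in> joined V E)"

definition Gamma_verts :: "nat set" where
  "Gamma_verts = {1..}"

definition Gamma_edges :: "nat set set" where
  "Gamma_edges = {{n, T n} | n. n \<in> Gamma_verts}"

(* annular k is the map A_k; it is only meant for k \<ge> 1 and offsets r \<le> 2 * k. *)
definition annular :: "nat \<Rightarrow> nat \<Rightarrow> nat" where
  "annular k r =
     (let s = (LEAST s. 1 \<le> s \<and> (k + 1)\<^sup>2 \<le> (T ^^ s) (k\<^sup>2 + r))
      in (T ^^ s) (k\<^sup>2 + r) - (k + 1)\<^sup>2)"

(* Only meant for k \<ge> 2; the two subtractions from k\<^sup>2 and tau are then not truncated. *)
definition exit_set :: "nat \<Rightarrow> nat set" where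
  "exit_set k = {tau (k\<^sup>2 - j) - j | j. 1 \<le> j \<and> j \<le> 2 * k - 2 \<and> j \<le> tau (k\<^sup>2 - j)}"

primrec W :: "nat \<Rightarrow> nat \<Rightarrow> nat set" where
  "W k 0 = exit_set k"
| "W k (Suc s) = annular (k + s) ` W k s"

lemma equiv_joined: "equiv V (joined V E)"
proof (rule equivI)
  have "sym (adjacency E)"
    by (auto simp: sym_def adjacency_def insert_commute)
  then have "sym ((adjacency E)\<^sup>*)"
    by (rule sym_rtrancl)
  then show "sym (joined V E)"
    by (auto simp: sym_def joined_def)
qed (auto simp: joined_def refl_on_def trans_def)

lemma T_gt: "0 < n \<Longrightarrow> n < T n"
  by (auto simp: T_def tau_def card_gt_0_iff)

lemma T_iterate_ge: "0 < n \<Longrightarrow> n + s \<le> (T ^^ s) n"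
proof (induction s)
  case (Suc s)
  then have "(T ^^ s) n < T ((T ^^ s) n)"
    by (intro T_gt) simp
  with Suc show ?case by simp
qed simp

(* The minimum in the definition of annular is over a nonempty set. *)
lemma annular_exit_exists:
  assumes "1 \<le> k"
  shows "\<exists>s\<ge>1. (k + 1)\<^sup>2 \<le> (T ^^ s) (k\<^sup>2 + r)"
proof (intro exI conjI)
  show "(k + 1)\<^sup>2 \<le> (T ^^ (k + 1)\<^sup>2) (k\<^sup>2 + r)"
    using T_iterate_ge[of "k\<^sup>2 + r" "(k + 1)\<^sup>2"] assms by simp
qed simp

end

theory Submission
  imports Defs
begin

text \<open>
  An integer \<^term>\<open>m\<close> below \<^term>\<open>k\<^sup>2\<close> has at most \<^term>\<open>2 * k - 2\<close> divisors, since each divisor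
  or its codivisor is below \<^term>\<open>k\<close>.  Therefore a \<^term>\<open>T\<close>-orbit that starts below
  \<^term>\<open>k\<^sup>2\<close> jumps across \<^term>\<open>k\<^sup>2\<close> from one of the \<^term>\<open>2 * k - 2\<close> integers just below it, and so lands
  at \<^term>\<open>k\<^sup>2 + r\<close> for some \<^term>\<open>r \<in> exit_set k\<close> (\<open>crosses_square_at_exit\<close>).
  From there the transfer maps follow the same orbit across the later squares, so every
  vertex below \<^term>\<open>k\<^sup>2\<close> lies in the component of some \<^term>\<open>(k + s)\<^sup>2 + w\<close> with
  \<^term>\<open>w \<in> W k s\<close>, for every \<^term>\<open>s\<close> (\<open>joined_to_W\<close>).

  Hence at most \<^term>\<open>card (W k s)\<close> components meet \<open>{1..<k\<^sup>2}\<close>.  Any \<^term>\<open>L + 1\<close> components all meet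
  \<open>{1..<k\<^sup>2}\<close> once \<^term>\<open>k\<close> is large, so a bound \<^term>\<open>L\<close> that holds for arbitrarily large
  \<^term>\<open>k\<close> bounds the total number of components (\<open>card_components_le\<close>).
  The two limit inferior criteria are the case \<open>s = 1\<close>, because an extended natural
  sequence with limit inferior at most \<^term>\<open>L\<close> takes values at most \<^term>\<open>L\<close> infinitely often.
\<close>

text \<open>
  The divisors of \<^term>\<open>m\<close> below \<^term>\<open>k\<close> and their codivisors exhaust all divisors.  The
  resulting bound is exactly the range of \<open>j\<close> in \<^const>\<open>exit_set\<close>.
\<close>

lemma tau_le_below_square:
  assumes "0 < m" "m < k\<^sup>2"
  shows "tau m \<le> 2 * k - 2"
proof -
  have sub: "{d. d dvd m} \<subseteq> {1..<k} \<union> (\<lambda>d. m div d) ` {1..<k}"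
  proof
    fix d assume "d \<in> {d. d dvd m}"
    then obtain e where e: "m = d * e" by (auto elim: dvdE)
    with assms have pos: "0 < d" "0 < e" by auto
    have "d < k \<or> e < k"
    proof (rule ccontr)
      assume "\<not> (d < k \<or> e < k)"
      then have "k * k \<le> d * e" by (intro mult_le_mono) auto
      with e assms show False by (simp add: power2_eq_square)
    qed
    moreover have "d = m div e" using e pos by simp
    ultimately show "d \<in> {1..<k} \<union> (\<lambda>d. m div d) ` {1..<k}"
      using pos by auto
  qed
  have "tau m \<le> card ({1..<k} \<union> (\<lambda>d. m div d) ` {1..<k})"
    unfolding tau_def by (intro card_mono sub) simp
  also have "\<dots> \<le> card {1..<k} + card ((\<lambda>d. m div d) ` {1..<k})"
    by (rule card_Un_le)
  also have "\<dots> \<le> card {1..<k} + card {1..<k}"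
    by (intro add_left_mono card_image_le) simp
  finally show ?thesis by simp
qed

lemma crosses_square_at_exit:
  assumes "0 < n" "n < k\<^sup>2"
  shows "\<exists>s. \<exists>r\<in>exit_set k. (T ^^ s) n = k\<^sup>2 + r"
proof -
  define s where "s = (LEAST s. k\<^sup>2 \<le> (T ^^ s) n)"
  have "k\<^sup>2 \<le> (T ^^ k\<^sup>2) n"
    using T_iterate_ge[OF assms(1), of "k\<^sup>2"] by simp
  then have s: "k\<^sup>2 \<le> (T ^^ s) n"
    unfolding s_def by (rule LeastI)
  with assms obtain p where p: "s = Suc p" by (cases s) auto
  define m where "m = (T ^^ p) n"
  have "m < k\<^sup>2"
    using not_less_Least[of p "\<lambda>s. k\<^sup>2 \<le> (T ^^ s) n"] p unfolding s_def m_def by simp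
  moreover have "0 < m"
    using T_iterate_ge[OF assms(1), of p] assms(1) unfolding m_def by simp
  ultimately have tau: "tau m \<le> 2 * k - 2" by (intro tau_le_below_square)
  \<comment> \<open>The jump starts at distance \<open>j\<close> below the square, and a jump of length at most
      \<open>2 * k - 2\<close> that crosses the square has \<open>j\<close> in the range of the exit set.\<close>
  define j where "j = k\<^sup>2 - m"
  have m_eq: "m = k\<^sup>2 - j" and "1 \<le> j"
    using \<open>m < k\<^sup>2\<close> by (auto simp: j_def)
  have "k\<^sup>2 \<le> m + tau m"
    using s p by (simp add: m_def T_def)
  then have j: "j \<le> tau m" by (simp add: j_def)
  have "tau m - j \<in> exit_set k"
    unfolding exit_set_def using j tau \<open>1 \<le> j\<close> m_eq by auto
  moreover have "(T ^^ s) n = k\<^sup>2 + (tau m - j)"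
    using p j \<open>m < k\<^sup>2\<close> by (simp add: m_def[symmetric] T_def j_def)
  ultimately show ?thesis by blast
qed

lemma annular_on_orbit:
  assumes "1 \<le> k"
  shows "\<exists>s. (T ^^ s) (k\<^sup>2 + r) = (k + 1)\<^sup>2 + annular k r"
proof -
  let ?s = "LEAST s. 1 \<le> s \<and> (k + 1)\<^sup>2 \<le> (T ^^ s) (k\<^sup>2 + r)"
  have "(k + 1)\<^sup>2 \<le> (T ^^ ?s) (k\<^sup>2 + r)"
    using LeastI_ex[OF annular_exit_exists[OF assms, of r]] by blast
  then show ?thesis
    by (intro exI[of _ ?s]) (simp add: annular_def Let_def)
qed

lemma joined_trans:
  "(u, v) \<in> joined V E \<Longrightarrow> (v, w) \<in> joined V E \<Longrightarrow> (u, w) \<in> joined V E"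
  by (auto simp: joined_def)

lemma joined_T_iterate:
  assumes "0 < n"
  shows "(n, (T ^^ s) n) \<in> joined Gamma_verts Gamma_edges"
proof (induction s)
  case 0
  show ?case using assms by (simp add: joined_def Gamma_verts_def)
next
  case (Suc s)
  let ?m = "(T ^^ s) n"
  have "?m \<in> Gamma_verts"
    using Suc by (simp add: joined_def)
  moreover from this have "T ?m \<in> Gamma_verts"
    by (simp add: Gamma_verts_def T_def)
  moreover have "(?m, T ?m) \<in> adjacency Gamma_edges"
    using \<open>?m \<in> Gamma_verts\<close> by (auto simp: adjacency_def Gamma_edges_def)
  ultimately have "(?m, T ?m) \<in> joined Gamma_verts Gamma_edges"
    by (auto simp: joined_def)
  with Suc show ?case by (auto intro: joined_trans)
qed

text \<open>
  The sets \<^term>\<open>W k s\<close> record, for increasing \<^term>\<open>s\<close>, where all the orbits starting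
  below \<^term>\<open>k\<^sup>2\<close> cross the successive squares.  When two of them merge the set can shrink, and
  its size always bounds the number of components met below \<^term>\<open>k\<^sup>2\<close>.
\<close>

lemma joined_to_W:
  assumes "0 < n" "n < k\<^sup>2"
  shows "\<exists>w\<in>W k s. (n, (k + s)\<^sup>2 + w) \<in> joined Gamma_verts Gamma_edges"
proof (induction s)
  case 0
  obtain t r where "r \<in> exit_set k" "(T ^^ t) n = k\<^sup>2 + r"
    using crosses_square_at_exit[OF assms] by blast
  then show ?case using joined_T_iterate[OF assms(1), of t] by auto
next
  case (Suc s)
  then obtain w where w: "w \<in> W k s"
    "(n, (k + s)\<^sup>2 + w) \<in> joined Gamma_verts Gamma_edges" by blast
  have "1 \<le> k + s" using assms by (cases k) auto
  then obtain t where t: "(T ^^ t) ((k + s)\<^sup>2 + w) = (k + s + 1)\<^sup>2 + annular (k + s) w"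
    using annular_on_orbit by blast
  have "0 < (k + s)\<^sup>2 + w" using \<open>1 \<le> k + s\<close> by (simp add: Suc_le_eq)
  from joined_T_iterate[OF this, of t]
  have "(n, (k + Suc s)\<^sup>2 + annular (k + s) w) \<in> joined Gamma_verts Gamma_edges"
    unfolding t by (auto intro: joined_trans[OF w(2)])
  with w(1) show ?case by auto
qed

lemma finite_W: "finite (W k s)"
proof (induction s)
  case 0
  have "exit_set k \<subseteq> (\<lambda>j. tau (k\<^sup>2 - j) - j) ` {..2 * k - 2}"
    by (auto simp: exit_set_def)
  then show ?case by (auto intro: finite_subset)
qed simp

text \<open>
  Any \<^term>\<open>Suc L\<close> components have representatives below a common bound \<open>N\<close>.  Each of them
  then contains an element of the set of at most \<^term>\<open>L\<close> hubs for \<open>N\<close>, and distinct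
  components are disjoint, which contradicts the pigeonhole principle.
\<close>

lemma card_components_le:
  fixes V :: "nat set"
  assumes hubs: "\<And>N. \<exists>S. finite S \<and> card S \<le> L \<and>
                   (\<forall>n\<in>V. n < N \<longrightarrow> (\<exists>w\<in>S. (n, w) \<in> joined V E))"
  shows "finite (components V E) \<and> card (components V E) \<le> L"
proof (rule ccontr)
  assume many: "\<not> ?thesis"
  have "\<exists>F. F \<subseteq> components V E \<and> finite F \<and> card F = Suc L"
  proof (cases "finite (components V E)")
    case True
    with many have "Suc L \<le> card (components V E)" by simp
    from obtain_subset_with_card_n[OF this] show ?thesis by metis
  next
    case False
    from infinite_arbitrarily_large[OF this, of "Suc L"] show ?thesis by blast
  qed
  then obtain F where F: "F \<subseteq> components V E" "finite F" "card F = Suc L" by blast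
  have "\<forall>X\<in>F. \<exists>n\<in>V. X = joined V E `` {n}"
    using F(1) by (auto simp: components_def elim!: quotientE)
  then obtain rep where rep: "\<And>X. X \<in> F \<Longrightarrow> rep X \<in> V \<and> X = joined V E `` {rep X}"
    by metis
  have "\<And>X. X \<in> F \<Longrightarrow> rep X < Suc (Max (rep ` F))"
    using F(2) by (simp add: le_imp_less_Suc)
  moreover obtain S where S: "finite S" "card S \<le> L"
    "\<forall>n\<in>V. n < Suc (Max (rep ` F)) \<longrightarrow> (\<exists>w\<in>S. (n, w) \<in> joined V E)"
    using hubs by blast
  ultimately have "\<forall>X\<in>F. \<exists>w\<in>S. w \<in> X"
    using rep by blast
  then obtain g where g: "\<And>X. X \<in> F \<Longrightarrow> g X \<in> S \<and> g X \<in> X" by metis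
  have "inj_on g F"
  proof (rule inj_onI)
    fix X Y assume "X \<in> F" "Y \<in> F" "g X = g Y"
    moreover from this have "X \<inter> Y \<noteq> {}" using g by (metis IntI empty_iff)
    ultimately show "X = Y"
      using quotient_disj[OF equiv_joined[of V E], of X Y] F(1) unfolding components_def by blast
  qed
  then have "card F \<le> card S"
    using g S(1) by (intro card_inj_on_le) auto
  with S(2) F(3) show False by simp
qed

lemma card_components_le_W:
  assumes "\<forall>K. \<exists>k\<ge>K. \<exists>s. card (W k s) \<le> L"
  shows "finite (components Gamma_verts Gamma_edges) \<and>
         card (components Gamma_verts Gamma_edges) \<le> L"
proof (rule card_components_le)
  fix N
  obtain k s where k: "N \<le> k" "card (W k s) \<le> L" using assms by blast
  let ?S = "(\<lambda>w. (k + s)\<^sup>2 + w) ` W k s"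
  have "\<exists>w\<in>?S. (n, w) \<in> joined Gamma_verts Gamma_edges" if "n \<in> Gamma_verts" "n < N" for n
  proof -
    have "k \<le> k\<^sup>2" by (simp add: power2_eq_square)
    with that(2) k(1) have "n < k\<^sup>2" by linarith
    with that(1) joined_to_W[of n k s] show ?thesis by (auto simp: Gamma_verts_def)
  qed
  moreover have "card ?S \<le> L" using card_image_le[OF finite_W] k(2) by (rule order_trans)
  ultimately show "\<exists>S. finite S \<and> card S \<le> L \<and>
      (\<forall>n\<in>Gamma_verts. n < N \<longrightarrow> (\<exists>w\<in>S. (n, w) \<in> joined Gamma_verts Gamma_edges))"
    using finite_W by (intro exI[of _ ?S]) simp
qed

lemma connected_graph_if_card_components_le_1:
  assumes "V \<noteq> {}" "finite (components V E)" "card (components V E) \<le> 1"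
  shows "connected_graph V E"
proof -
  have "(u, v) \<in> joined V E" if "u \<in> V" "v \<in> V" for u v
  proof -
    have "joined V E `` {u} = joined V E `` {v}"
      using assms(2,3) quotientI[OF that(1)] quotientI[OF that(2)]
      by (simp add: card_le_Suc0_iff_eq components_def)
    with that show ?thesis using eq_equiv_class[OF _ equiv_joined] by metis
  qed
  with assms(1) show ?thesis by (simp add: connected_graph_def)
qed

lemma frequently_le_if_liminf_le:
  fixes f :: "nat \<Rightarrow> nat"
  assumes "liminf (\<lambda>k. enat (f k)) \<le> enat L"
  shows "\<exists>k\<ge>K. f k \<le> L"
proof (rule ccontr)
  assume "\<not> ?thesis"
  then have "\<forall>k\<ge>K. L < f k" by (meson not_le)
  then have "\<forall>k\<ge>K. enat (Suc L) \<le> enat (f k)" by (simp add: Suc_le_eq)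
  then have "enat (Suc L) \<le> liminf (\<lambda>k. enat (f k))"
    by (intro Liminf_bounded) (auto simp: eventually_sequentially)
  with assms have "enat (Suc L) \<le> enat L" by (rule order_trans[rotated])
  then show False by simp
qed

lemma card_components_le_liminf:
  assumes "liminf (\<lambda>k. enat (card (annular k ` exit_set k))) \<le> enat L"
  shows "finite (components Gamma_verts Gamma_edges) \<and>
         card (components Gamma_verts Gamma_edges) \<le> L"
proof (rule card_components_le_W, rule allI)
  fix K
  obtain k where "K \<le> k" "card (annular k ` exit_set k) \<le> L"
    using frequently_le_if_liminf_le[OF assms] by blast
  then have "K \<le> k" "card (W k 1) \<le> L" by simp_all
  then show "\<exists>k\<ge>K. \<exists>s. card (W k s) \<le> L" by blast
qed

theorem corollary5p10:
  shows "(\<forall>L::nat. (\<forall>K. \<exists>k\<ge>K. 2 \<le> k \<and> (\<exists>s. card (W k s) \<le> L)) \<longrightarrow>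
            finite (components Gamma_verts Gamma_edges) \<and>
            card (components Gamma_verts Gamma_edges) \<le> L)
       \<and> (liminf (\<lambda>k. enat (card (annular k ` exit_set k))) = 1 \<longrightarrow>
            connected_graph Gamma_verts Gamma_edges)
       \<and> (liminf (\<lambda>k. enat (card (annular k ` exit_set k))) \<le> 2 \<longrightarrow>
            finite (components Gamma_verts Gamma_edges) \<and>
            card (components Gamma_verts Gamma_edges) \<le> 2)"
proof (intro conjI allI impI)
  fix L
  assume "\<forall>K. \<exists>k\<ge>K. 2 \<le> k \<and> (\<exists>s. card (W k s) \<le> L)"
  then have "\<forall>K. \<exists>k\<ge>K. \<exists>s. card (W k s) \<le> L" by blast
  from card_components_le_W[OF this]
  show "finite (components Gamma_verts Gamma_edges)"
    and "card (components Gamma_verts Gamma_edges) \<le> L" by simp_all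
next
  assume "liminf (\<lambda>k. enat (card (annular k ` exit_set k))) = 1"
  then have "liminf (\<lambda>k. enat (card (annular k ` exit_set k))) \<le> enat 1"
    by (simp add: one_enat_def)
  from card_components_le_liminf[OF this] show "connected_graph Gamma_verts Gamma_edges"
    by (intro connected_graph_if_card_components_le_1) (auto simp: Gamma_verts_def)
next
  assume "liminf (\<lambda>k. enat (card (annular k ` exit_set k))) \<le> 2"
  then have "liminf (\<lambda>k. enat (card (annular k ` exit_set k))) \<le> enat 2"
    by (simp add: numeral_eq_enat)
  from card_components_le_liminf[OF this]
  show "finite (components Gamma_verts Gamma_edges)"
    and "card (components Gamma_verts Gamma_edges) \<le> 2" by simp_all
qed

end
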